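(* (i) Let $\mathbb{F} \in \{\mathbb{R}, \mathbb{C}, \mathbb{H}\}$, $k \in \mathbb{N}$, and let $X$ be a left (resp. right) topological vector space over $\mathbb{F}$. Then the set $$\mathcal{U}_k := \{(x_1, \ldots, x_k) \in X^k : x_1, \ldots, x_k \text{ are linearly independent}\}$$ is open with respect to the product topology of $X^k$. In particular, if $(X, \|\cdot\|)$ is a left (resp. right) normed linear space over $\mathbb{F}$, then, given linearly independent vectors $x_1,\dots,x_k \in X$, there exists an $\varepsilon > 0$ such that the vectors $y_1, \ldots, y_k \in X$ are linearly independent whenever $$\max_{1 \leq i \leq k} \|y_i - x_i\| < \varepsilon.$$ (ii) Let $\mathbb{F}$, $k$, $X$ and $\mathcal{U}_k$ be as in the first sentence of (i). Then the set $\mathcal{U}_k$ is dense in $X^k$ whenever it is nonempty.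
   Context: $\mathbb{H}$ denotes the division ring of real quaternions. Topological vector spaces are Hausdorff: a left (resp. right) topological vector space over $\mathbb{F}$ is a left (resp. right) vector space over $\mathbb{F}$ with a Hausdorff topology making addition and multiplication by scalars continuous. Linear independence (left, resp. right, over $\mathbb{F}$) is that of the $k$-tuple as an indexed family, so a tuple with repeated entries is dependent. *)

theory Defs
  imports "HOL-Analysis.Analysis"
begin

datatype quat = Quat (qre: real) (qi: real) (qj: real) (qk: real)

lemma quat_eq_iff: "x = y \<longleftrightarrow> qre x = qre y \<and> qi x = qi y \<and> qj x = qj y \<and> qk x = qk y"
  by (cases x; cases y) simp

instantiation quat :: real_vector
begin

definition "0 = Quat 0 0 0 0"
definition "x + y = Quat (qre x + qre y) (qi x + qi y) (qj x + qj y) (qk x + qk y)"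
definition "- x = Quat (- qre x) (- qi x) (- qj x) (- qk x)"
definition "x - y = Quat (qre x - qre y) (qi x - qi y) (qj x - qj y) (qk x - qk y)"
definition "scaleR r x = Quat (r * qre x) (r * qi x) (r * qj x) (r * qk x)"

instance
  by standard (simp_all add: quat_eq_iff zero_quat_def plus_quat_def uminus_quat_def
      minus_quat_def scaleR_quat_def algebra_simps)

end

lemmas quat_linear_defs =
  zero_quat_def plus_quat_def uminus_quat_def minus_quat_def scaleR_quat_def

instantiation quat :: real_algebra_1
begin

definition "1 = Quat 1 0 0 0"

text \<open>Hamilton's relations \<open>i\<^sup>2 = j\<^sup>2 = k\<^sup>2 = ijk = -1\<close>, extended bilinearly.\<close>
definition "x * y = Quat
  (qre x * qre y - qi x * qi y - qj x * qj y - qk x * qk y)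
  (qre x * qi y + qi x * qre y + qj x * qk y - qk x * qj y)
  (qre x * qj y - qi x * qk y + qj x * qre y + qk x * qi y)
  (qre x * qk y + qi x * qj y - qj x * qi y + qk x * qre y)"

instance
  by standard (simp_all add: quat_eq_iff quat_linear_defs one_quat_def times_quat_def algebra_simps)

end

lemma quat_norm_sq_nonzero:
  "x \<noteq> 0 \<Longrightarrow> (qre x)\<^sup>2 + (qi x)\<^sup>2 + (qj x)\<^sup>2 + (qk x)\<^sup>2 \<noteq> 0"
  by (auto simp: quat_eq_iff zero_quat_def add_nonneg_eq_0_iff)

instantiation quat :: real_div_algebra
begin

definition "inverse x = (let n = (qre x)\<^sup>2 + (qi x)\<^sup>2 + (qj x)\<^sup>2 + (qk x)\<^sup>2
  in Quat (qre x / n) (- qi x / n) (- qj x / n) (- qk x / n))"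

definition "x div y = x * inverse y" for x y :: quat

instance
proof
  fix x y :: quat
  show "inverse x * x = 1" "x * inverse x = 1" if "x \<noteq> 0"
    using quat_norm_sq_nonzero[OF that]
    by (auto simp: quat_eq_iff one_quat_def times_quat_def inverse_quat_def Let_def
        divide_simps power2_eq_square)
  show "inverse (0::quat) = 0"
    by (simp add: quat_eq_iff zero_quat_def inverse_quat_def)
  show "x div y = x * inverse y"
    by (simp add: divide_quat_def)
qed

end

instantiation quat :: real_normed_div_algebra
begin

definition "norm x = sqrt ((qre x)\<^sup>2 + (qi x)\<^sup>2 + (qj x)\<^sup>2 + (qk x)\<^sup>2)"
definition "sgn x = x /\<^sub>R norm x" for x :: quat
definition "dist x y = norm (x - y)" for x y :: quat
definition
  "(uniformity :: (quat \<times> quat) filter) = (INF e\<in>{0 <..}. principal {(x, y). dist x y < e})"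
definition
  "open U \<longleftrightarrow> (\<forall>x\<in>U. \<forall>\<^sub>F (x', y) in uniformity. x' = x \<longrightarrow> y \<in> U)" for U :: "quat set"

instance
proof
  fix x y :: quat and a :: real and U :: "quat set"
  have norm_prod: "norm z = norm (qre z, qi z, qj z, qk z)" for z :: quat
    by (simp add: norm_quat_def norm_prod_def add.assoc)
  show "dist x y = norm (x - y)"
    by (rule dist_quat_def)
  show "sgn x = x /\<^sub>R norm x"
    by (rule sgn_quat_def)
  show "(uniformity :: (quat \<times> quat) filter) = (INF e\<in>{0 <..}. principal {(x, y). dist x y < e})"
    by (rule uniformity_quat_def)
  show "open U \<longleftrightarrow> (\<forall>x\<in>U. \<forall>\<^sub>F (x', y) in uniformity. x' = x \<longrightarrow> y \<in> U)"
    by (rule open_quat_def)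
  show "norm x = 0 \<longleftrightarrow> x = 0"
    unfolding norm_prod by (simp add: quat_eq_iff zero_quat_def zero_prod_def)
  show "norm (x + y) \<le> norm x + norm y"
    unfolding norm_prod
    using norm_triangle_ineq[of "(qre x, qi x, qj x, qk x)" "(qre y, qi y, qj y, qk y)"]
    by (simp add: plus_quat_def)
  show "norm (a *\<^sub>R x) = \<bar>a\<bar> * norm x"
    unfolding norm_prod using norm_scaleR[of a "(qre x, qi x, qj x, qk x)"]
    by (simp add: scaleR_quat_def)
  show "norm (x * y) = norm x * norm y"
    unfolding norm_quat_def real_sqrt_mult[symmetric]
    by (simp add: times_quat_def power2_eq_square algebra_simps)
qed

end

text \<open>A type variable of this class ranges over the real numbers, the complex numbers and the
  quaternions, up to norm-preserving ring isomorphism.\<close>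
class real_complex_quat = real_normed_div_algebra +
  assumes real_complex_quat:
    "(\<exists>\<phi> :: 'a \<Rightarrow> real. bij \<phi> \<and> (\<forall>x y. \<phi> (x + y) = \<phi> x + \<phi> y) \<and>
        (\<forall>x y. \<phi> (x * y) = \<phi> x * \<phi> y) \<and> (\<forall>x. norm (\<phi> x) = norm x)) \<or>
     (\<exists>\<phi> :: 'a \<Rightarrow> complex. bij \<phi> \<and> (\<forall>x y. \<phi> (x + y) = \<phi> x + \<phi> y) \<and>
        (\<forall>x y. \<phi> (x * y) = \<phi> x * \<phi> y) \<and> (\<forall>x. norm (\<phi> x) = norm x)) \<or>
     (\<exists>\<phi> :: 'a \<Rightarrow> quat. bij \<phi> \<and> (\<forall>x y. \<phi> (x + y) = \<phi> x + \<phi> y) \<and>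
        (\<forall>x y. \<phi> (x * y) = \<phi> x * \<phi> y) \<and> (\<forall>x. norm (\<phi> x) = norm x))"

instance real :: real_complex_quat
  by standard (rule disjI1, rule exI[of _ id], simp)

instance complex :: real_complex_quat
  by standard (rule disjI2, rule disjI1, rule exI[of _ id], simp)

instance quat :: real_complex_quat
  by standard (rule disjI2, rule disjI2, rule exI[of _ id], simp)

text \<open>The library's \<^locale>\<open>module\<close> and \<^locale>\<open>vector_space\<close> require commutative scalars.\<close>

locale left_vector_space =
  fixes smul :: "'f::division_ring \<Rightarrow> 'x::ab_group_add \<Rightarrow> 'x"
  assumes smul_add_right: "smul a (x + y) = smul a x + smul a y"
    and smul_add_left: "smul (a + b) x = smul a x + smul b x"
    and smul_smul: "smul a (smul b x) = smul (a * b) x"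
    and smul_one: "smul 1 x = x"

locale right_vector_space =
  fixes smul :: "'x::ab_group_add \<Rightarrow> 'f::division_ring \<Rightarrow> 'x"
  assumes smul_add_left: "smul (x + y) a = smul x a + smul y a"
    and smul_add_right: "smul x (a + b) = smul x a + smul x b"
    and smul_smul: "smul (smul x a) b = smul x (a * b)"
    and smul_one: "smul x 1 = x"

locale vector_topology =
  fixes T :: "'x::ab_group_add topology"
  assumes topspace_UNIV: "topspace T = UNIV"
    and Hausdorff: "Hausdorff_space T"
    and continuous_add: "continuous_map (prod_topology T T) T (\<lambda>(x, y). x + y)"

locale left_topological_vector_space = left_vector_space smul + vector_topology T
  for T :: "'x::ab_group_add topology" and smul :: "'f::real_normed_div_algebra \<Rightarrow> 'x \<Rightarrow> 'x" +
  assumes continuous_smul: "continuous_map (prod_topology euclidean T) T (\<lambda>(a, x). smul a x)"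

locale right_topological_vector_space = right_vector_space smul + vector_topology T
  for T :: "'x::ab_group_add topology" and smul :: "'x \<Rightarrow> 'f::real_normed_div_algebra \<Rightarrow> 'x" +
  assumes continuous_smul: "continuous_map (prod_topology T euclidean) T (\<lambda>(x, a). smul x a)"

locale left_normed_space = left_vector_space smul
  for smul :: "'f::real_normed_div_algebra \<Rightarrow> 'x::ab_group_add \<Rightarrow> 'x" +
  fixes nrm :: "'x \<Rightarrow> real"
  assumes nrm_eq_zero: "nrm x = 0 \<longleftrightarrow> x = 0"
    and nrm_triangle: "nrm (x + y) \<le> nrm x + nrm y"
    and nrm_smul: "nrm (smul a x) = norm a * nrm x"

locale right_normed_space = right_vector_space smul
  for smul :: "'x::ab_group_add \<Rightarrow> 'f::real_normed_div_algebra \<Rightarrow> 'x" +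
  fixes nrm :: "'x \<Rightarrow> real"
  assumes nrm_eq_zero: "nrm x = 0 \<longleftrightarrow> x = 0"
    and nrm_triangle: "nrm (x + y) \<le> nrm x + nrm y"
    and nrm_smul: "nrm (smul x a) = nrm x * norm a"

text \<open>A \<open>k\<close>-tuple is a function on the index set \<open>{1..k}\<close>; independence is that of the indexed
  family. In the sets below, tuples are extensional, so that they are the points of
  \<open>product_topology (\<lambda>_. T) {1..k}\<close>.\<close>

definition left_independent ::
    "('f::division_ring \<Rightarrow> 'x::ab_group_add \<Rightarrow> 'x) \<Rightarrow> nat \<Rightarrow> (nat \<Rightarrow> 'x) \<Rightarrow> bool" where
  "left_independent smul k x \<longleftrightarrow>
    (\<forall>c. (\<Sum>i\<in>{1..k}. smul (c i) (x i)) = 0 \<longrightarrow> (\<forall>i\<in>{1..k}. c i = 0))"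

definition right_independent ::
    "('x::ab_group_add \<Rightarrow> 'f::division_ring \<Rightarrow> 'x) \<Rightarrow> nat \<Rightarrow> (nat \<Rightarrow> 'x) \<Rightarrow> bool" where
  "right_independent smul k x \<longleftrightarrow>
    (\<forall>c. (\<Sum>i\<in>{1..k}. smul (x i) (c i)) = 0 \<longrightarrow> (\<forall>i\<in>{1..k}. c i = 0))"

definition left_independent_tuples ::
    "('f::division_ring \<Rightarrow> 'x::ab_group_add \<Rightarrow> 'x) \<Rightarrow> nat \<Rightarrow> (nat \<Rightarrow> 'x) set" where
  "left_independent_tuples smul k = {x \<in> {1..k} \<rightarrow>\<^sub>E UNIV. left_independent smul k x}"

definition right_independent_tuples ::
    "('x::ab_group_add \<Rightarrow> 'f::division_ring \<Rightarrow> 'x) \<Rightarrow> nat \<Rightarrow> (nat \<Rightarrow> 'x) set" where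
  "right_independent_tuples smul k = {x \<in> {1..k} \<rightarrow>\<^sub>E UNIV. right_independent smul k x}"

end

theory Submission
  imports Defs
begin

text \<open>
  A tuple is dependent iff it is annihilated by a coefficient tuple of maximum norm \<open>1\<close>. Such
  coefficient tuples form a compact set because \<open>\<real>\<close>, \<open>\<complex>\<close> and the quaternions are
  finite-dimensional over \<open>\<real>\<close>. Hence the dependent tuples are the projection, along a compact
  factor, of a closed set, and so are closed. For density, let \<open>u\<close> be independent and \<open>y\<close> arbitrary.
  If \<open>y + r u\<close> is dependent for a real \<open>r\<close>, choose a nontrivial annihilating coefficient tuple
  \<open>c\<^sub>r\<close>. The vectors \<open>\<Sum>\<^sub>i c\<^sub>r\<^sub>i u\<^sub>i\<close> behave like eigenvectors for the distinct eigenvalues \<open>-r\<close>,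
  so they are independent over \<open>\<real>\<close>. They lie in a finite-dimensional real space, so only
  finitely many \<open>r\<close> occur. Since only real scalars, which are central, are ever multiplied with
  other scalars, left and right spaces can be treated alike.
\<close>

section \<open>Finite-dimensional scalars\<close>

text \<open>The class of scalars provides additive isometries without real homogeneity. Evaluating
  the norm of \<open>f (r *\<^sub>R x + x)\<close> in two ways determines the inner product of
  \<open>f (r *\<^sub>R x)\<close> with \<open>f x\<close>, and then
  \<open>f (r *\<^sub>R x)\<close> has distance \<open>0\<close> from
  \<open>r *\<^sub>R f x\<close>.\<close>

lemma additive_isometry_imp_linear:
  fixes f :: "'a::real_normed_vector \<Rightarrow> 'b::real_inner"
  assumes add: "\<And>x y. f (x + y) = f x + f y" and isom: "\<And>x. norm (f x) = norm x"
  shows "linear f"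
proof (rule linearI)
  fix r :: real and x :: 'a
  have "(norm (f (r *\<^sub>R x + x)))\<^sup>2 = ((r + 1) * norm x)\<^sup>2"
    unfolding isom using norm_scaleR[of "r + 1" x]
    by (simp add: scaleR_add_left power_mult_distrib)
  moreover have "(norm (f (r *\<^sub>R x + x)))\<^sup>2
      = (r * norm x)\<^sup>2 + 2 * (f (r *\<^sub>R x) \<bullet> f x) + (norm x)\<^sup>2"
    unfolding add power2_norm_eq_inner inner_add
    by (simp add: inner_commute isom power_mult_distrib flip: power2_norm_eq_inner)
  ultimately have ip: "f (r *\<^sub>R x) \<bullet> f x = r * (norm x)\<^sup>2"
    by (simp add: power2_eq_square algebra_simps)
  have "(norm (f (r *\<^sub>R x) - r *\<^sub>R f x))\<^sup>2
      = (norm (f (r *\<^sub>R x)))\<^sup>2 - 2 * r * (f (r *\<^sub>R x) \<bullet> f x) + r\<^sup>2 * (norm (f x))\<^sup>2"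
    unfolding power2_norm_eq_inner
    by (simp add: inner_diff inner_commute power2_eq_square algebra_simps)
  also have "\<dots> = 0"
    by (simp add: ip isom power_mult_distrib power2_eq_square algebra_simps)
  finally show "f (r *\<^sub>R x) = r *\<^sub>R f x"
    by simp
qed (rule add)

text \<open>The inverse of \<open>f\<close> is a linear isometry too, so it carries the compact unit
  ball and the finite basis of the Euclidean space back to \<open>'a\<close>.\<close>

lemma additive_isometry_finite_dim:
  fixes f :: "'a::real_normed_vector \<Rightarrow> 'b::euclidean_space"
  assumes add: "\<And>x y. f (x + y) = f x + f y" and isom: "\<And>x. norm (f x) = norm x"
    and "surj f"
  shows "compact (cball (0::'a) 1) \<and> (\<exists>B::'a set. finite B \<and> span B = UNIV)"
proof -
  have lin: "linear f"
    by (rule additive_isometry_imp_linear[OF add isom])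
  have "inj f"
    using linear_injective_0[OF lin] isom by (metis norm_eq_zero)
  define g where "g = inv f"
  have fg: "f (g z) = z" and gf: "g (f x) = x" for z x
    using \<open>inj f\<close> \<open>surj f\<close> by (simp_all add: g_def surj_f_inv_f)
  have lin_g: "linear g"
    by (rule linearI) (metis fg gf add, metis fg gf lin linear_scale)
  have norm_g: "norm (g z) = norm z" for z
    by (metis fg isom)
  have "continuous_on UNIV g"
    by (rule linear_continuous_on) (use lin_g norm_g in
      \<open>auto simp: bounded_linear_def bounded_linear_axioms_def intro!: exI[of _ 1]\<close>)
  then have "compact (g ` cball 0 1)"
    by (meson compact_cball compact_continuous_image continuous_on_subset subset_UNIV)
  moreover have "g ` cball 0 1 = cball 0 1"
  proof
    show "cball 0 1 \<subseteq> g ` cball 0 1"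
      by (rule subsetI, rule image_eqI[where f = g, OF gf[symmetric]]) (simp add: isom)
  qed (auto simp: norm_g)
  moreover have "span (g ` Basis) = UNIV"
    using linear_span_image[OF lin_g, of Basis] gf by (auto simp: image_iff) (metis gf)
  ultimately show ?thesis
    by (metis finite_Basis finite_imageI)
qed

lemma scalars_finite_dim:
  "compact (cball (0::'f::real_complex_quat) 1) \<and> (\<exists>B::'f set. finite B \<and> span B = UNIV)"
  using real_complex_quat[where 'a='f]
proof (elim disjE exE conjE)
  fix \<phi> :: "'f \<Rightarrow> quat"
  assume \<phi>: "bij \<phi>" "\<forall>x y. \<phi> (x + y) = \<phi> x + \<phi> y" "\<forall>x. norm (\<phi> x) = norm x"
  \<comment> \<open>The four coordinates identify \<open>quat\<close>, norm included, with a
    Euclidean space.\<close>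
  let ?f = "\<lambda>x. (qre (\<phi> x), qi (\<phi> x), qj (\<phi> x), qk (\<phi> x))"
  have "norm (?f x) = norm (\<phi> x)" for x
    by (simp add: norm_quat_def norm_prod_def add.assoc)
  moreover have "surj ?f"
  proof (rule surjI)
    fix z :: "real \<times> real \<times> real \<times> real"
    obtain a b c d where "z = (a, b, c, d)"
      by (metis surj_pair)
    then show "?f (inv \<phi> (case z of (a, b, c, d) \<Rightarrow> Quat a b c d)) = z"
      using \<phi>(1) by (simp add: bij_is_surj surj_f_inv_f)
  qed
  ultimately show ?thesis
    using \<phi> by (intro additive_isometry_finite_dim[of ?f]) (auto simp: plus_quat_def)
next
  fix \<phi> :: "'f \<Rightarrow> real"
  assume "bij \<phi>" "\<forall>x y. \<phi> (x + y) = \<phi> x + \<phi> y" "\<forall>x. norm (\<phi> x) = norm x"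
  then show ?thesis
    by (intro additive_isometry_finite_dim[of \<phi>]) (auto simp: bij_is_surj)
next
  fix \<phi> :: "'f \<Rightarrow> complex"
  assume "bij \<phi>" "\<forall>x y. \<phi> (x + y) = \<phi> x + \<phi> y" "\<forall>x. norm (\<phi> x) = norm x"
  then show ?thesis
    by (intro additive_isometry_finite_dim[of \<phi>]) (auto simp: bij_is_surj)
qed

section \<open>Normalized coefficient tuples\<close>

text \<open>Maximum norm \<open>1\<close> is attained at some index \<open>i\<close>, whence a
  finite union of products. The value \<open>0\<close> outside \<open>{1..k}\<close> keeps every
  factor of the infinite product compact.\<close>

definition unit_tuples :: "nat \<Rightarrow> (nat \<Rightarrow> 'f::real_normed_vector) set" where
  "unit_tuples k = (\<Union>i\<in>{1..k}. Pi\<^sub>E UNIV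
     (\<lambda>j. if j = i then sphere 0 1 else if j \<in> {1..k} then cball 0 1 else {0}))"

lemma unit_tuples_iff:
  "c \<in> unit_tuples k \<longleftrightarrow> (\<exists>i\<in>{1..k}. norm (c i) = 1) \<and> (\<forall>j\<in>{1..k}. norm (c j) \<le> 1)
     \<and> (\<forall>j. j \<notin> {1..k} \<longrightarrow> c j = 0)"
proof -
  have "c \<in> Pi\<^sub>E UNIV (\<lambda>j. if j = i then sphere 0 1 else if j \<in> {1..k} then cball 0 1 else {0})
      \<longleftrightarrow> norm (c i) = 1 \<and> (\<forall>j\<in>{1..k}. norm (c j) \<le> 1) \<and> (\<forall>j. j \<notin> {1..k} \<longrightarrow> c j = 0)"
    (is "_ = ?R") if "i \<in> {1..k}" for i
  proof -
    have "c j \<in> (if j = i then sphere 0 1 else if j \<in> {1..k} then cball 0 1 else {0})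
        \<longleftrightarrow> (j = i \<longrightarrow> norm (c j) = 1) \<and> (j \<in> {1..k} \<longrightarrow> norm (c j) \<le> 1)
          \<and> (j \<notin> {1..k} \<longrightarrow> c j = 0)" for j
      using that by auto
    then show ?thesis
      unfolding PiE_UNIV_domain Pi_iff by (metis UNIV_I)
  qed
  then show ?thesis
    unfolding unit_tuples_def by blast
qed

text \<open>Tychonoff's theorem applies to each product in the finite union; the sphere is a closed
  subset of the compact ball.\<close>

lemma compact_unit_tuples:
  assumes "compact (cball (0::'f::real_normed_vector) 1)"
  shows "compact (unit_tuples k :: (nat \<Rightarrow> 'f) set)"
proof -
  have "cball (0::'f) 1 \<inter> {a. norm a = 1} = sphere 0 1"
    by auto
  moreover have "closed {a::'f. norm a = 1}"
    by (intro closed_Collect_eq continuous_intros)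
  ultimately have sphere: "compact (sphere (0::'f) 1)"
    using compact_Int_closed[OF assms] by metis
  have "compactin (product_topology (\<lambda>_. euclidean) UNIV) (Pi\<^sub>E UNIV
      (\<lambda>j. if j = i then sphere (0::'f) 1 else if j \<in> {1..k} then cball 0 1 else {0}))" for i
    by (simp add: compactin_PiE sphere assms)
  then show ?thesis
    unfolding unit_tuples_def euclidean_product_topology
    by (intro compact_UN) (auto simp: compactin_euclidean_iff)
qed

section \<open>Dependent tuples\<close>

text \<open>With its arguments flipped, a right action composes scalars in reversed order.
  Composition is therefore governed only when one factor is real, where both orders agree.\<close>

locale real_scalar_action =
  fixes smul :: "'f::real_normed_div_algebra \<Rightarrow> 'x::ab_group_add \<Rightarrow> 'x"
  assumes action_add_right: "smul a (x + y) = smul a x + smul a y"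
    and action_add_left: "smul (a + b) x = smul a x + smul b x"
    and action_one: "smul 1 x = x"
    and action_of_real_left: "smul (of_real r) (smul a x) = smul (r *\<^sub>R a) x"
    and action_of_real_right: "smul a (smul (of_real r) x) = smul (r *\<^sub>R a) x"
begin

sublocale right_add: additive "smul a" for a
  by unfold_locales (rule action_add_right)

sublocale left_add: additive "\<lambda>a. smul a x" for x
  by unfold_locales (rule action_add_left)

text \<open>Restricting the scalars to the field of reals gives access to the bound on the size of
  independent sets in a finitely spanned space.\<close>

sublocale real_space: vector_space "\<lambda>r. smul (of_real r)"
  by unfold_locales
    (simp_all add: action_add_right action_add_left action_one action_of_real_left
      scaleR_conv_of_real)

definition comb :: "nat \<Rightarrow> (nat \<Rightarrow> 'f) \<Rightarrow> (nat \<Rightarrow> 'x) \<Rightarrow> 'x" where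
  "comb k c x = (\<Sum>i\<in>{1..k}. smul (c i) (x i))"

lemma independent_iff_comb:
  "left_independent smul k x \<longleftrightarrow> (\<forall>c. comb k c x = 0 \<longrightarrow> (\<forall>i\<in>{1..k}. c i = 0))"
  by (simp add: left_independent_def comb_def)

lemma comb_scaleR: "comb k (\<lambda>i. r *\<^sub>R c i) x = smul (of_real r) (comb k c x)"
  by (simp add: comb_def right_add.sum action_of_real_left)

lemma comb_sum: "comb k (\<lambda>i. \<Sum>s\<in>S. c s i) x = (\<Sum>s\<in>S. comb k (c s) x)"
  unfolding comb_def left_add.sum by (rule sum.swap)

lemma comb_diff: "comb k c (\<lambda>i. x i - y i) = comb k c x - comb k c y"
  by (simp add: comb_def right_add.diff sum_subtractf)

lemma comb_perturb:
  "comb k c (\<lambda>i. y i + smul (of_real r) (u i)) = comb k c y + smul (of_real r) (comb k c u)"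
  by (simp add: comb_def action_add_right sum.distrib right_add.sum
      action_of_real_left action_of_real_right)

lemma comb_cong:
  "(\<And>i. i \<in> {1..k} \<Longrightarrow> c i = d i) \<Longrightarrow> (\<And>i. i \<in> {1..k} \<Longrightarrow> x i = y i)
    \<Longrightarrow> comb k c x = comb k d y"
  by (simp add: comb_def)

lemma independent_cong:
  "(\<And>i. i \<in> {1..k} \<Longrightarrow> x i = y i) \<Longrightarrow> left_independent smul k x = left_independent smul k y"
  by (simp add: left_independent_def)

lemma dependent_iff_unit_tuple:
  "\<not> left_independent smul k x \<longleftrightarrow> (\<exists>c\<in>unit_tuples k. comb k c x = 0)"
proof
  assume "\<not> left_independent smul k x"
  then obtain c i where c: "comb k c x = 0" "i \<in> {1..k}" "c i \<noteq> 0"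
    by (auto simp: independent_iff_comb)
  \<comment> \<open>Dividing by the largest coefficient norm, positive because
    \<open>c i \<noteq> 0\<close>, normalizes the tuple; a real factor keeps the combination
    \<open>0\<close>.\<close>
  define m where "m = (MAX i\<in>{1..k}. norm (c i))"
  have le: "norm (c j) \<le> m" if "j \<in> {1..k}" for j
    unfolding m_def using that by (intro Max_ge) auto
  have "m \<in> (\<lambda>i. norm (c i)) ` {1..k}"
    unfolding m_def using c(2) by (intro Max_in) auto
  then obtain l where l: "l \<in> {1..k}" "norm (c l) = m"
    by auto
  have "m > 0"
    using le[OF c(2)] c(3) by (smt (verit) zero_less_norm_iff)
  define d where "d = (\<lambda>j. if j \<in> {1..k} then (1 / m) *\<^sub>R c j else 0)"
  have "comb k d x = comb k (\<lambda>i. (1 / m) *\<^sub>R c i) x"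
    by (rule comb_cong) (auto simp: d_def)
  then have "comb k d x = 0"
    by (simp only: comb_scaleR c(1) right_add.zero)
  moreover have "d \<in> unit_tuples k"
    unfolding unit_tuples_iff using l le \<open>m > 0\<close> by (auto simp: d_def intro!: bexI[of _ l])
  ultimately show "\<exists>c\<in>unit_tuples k. comb k c x = 0"
    by blast
next
  assume "\<exists>c\<in>unit_tuples k. comb k c x = 0"
  then obtain c i where "comb k c x = 0" "i \<in> {1..k}" "norm (c i) = 1"
    by (auto simp: unit_tuples_iff)
  moreover from this have "c i \<noteq> 0"
    by auto
  ultimately show "\<not> left_independent smul k x"
    unfolding independent_iff_comb by blast
qed

section \<open>Dependent members of the pencil \<open>y + r u\<close>\<close>

text \<open>As \<open>u\<close> is independent, sending \<open>comb k c u\<close> to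
  \<open>comb k c y\<close> is well defined and real-linear, and \<open>comb k (c r) u\<close> is an
  eigenvector for \<open>- r\<close>. The induction is the usual elimination of one eigenvalue
  \<open>q\<close> from a linear relation.\<close>

lemma pencil_independent:
  assumes u: "left_independent smul k u"
    and c: "\<And>r. r \<in> D \<Longrightarrow> comb k (c r) (\<lambda>i. y i + smul (of_real r) (u i)) = 0"
    and nz: "\<And>r. r \<in> D \<Longrightarrow> \<exists>i\<in>{1..k}. c r i \<noteq> 0"
    and "finite S" "S \<subseteq> D"
    and "(\<Sum>r\<in>S. smul (of_real (d r)) (comb k (c r) u)) = 0"
  shows "\<forall>r\<in>S. d r = 0"
  using assms(4-6)
proof (induction S arbitrary: d rule: finite_induct)
  case (insert q S)
  let ?v = "\<lambda>r. comb k (c r) u"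
  let ?R = "insert q S"
  have y: "comb k (c r) y = - smul (of_real r) (?v r)" if "r \<in> ?R" for r
    using c[of r] that insert.prems(1) by (auto simp: comb_perturb eq_neg_iff_add_eq_0)
  \<comment> \<open>The coefficient tuple of the whole relation: independence of \<open>u\<close>
    makes it vanish on \<open>{1..k}\<close>, so its combination with \<open>y\<close> vanishes as
    well. This gives a second relation, with coefficients \<open>d r * r\<close>.\<close>
  define e where "e = (\<lambda>i. \<Sum>r\<in>?R. d r *\<^sub>R c r i)"
  have comb_e: "comb k e x = (\<Sum>r\<in>?R. smul (of_real (d r)) (comb k (c r) x))" for x
    unfolding e_def comb_sum comb_scaleR ..
  have e0: "e i = 0" if "i \<in> {1..k}" for i
    using u that insert.prems(2) comb_e[of u] unfolding independent_iff_comb by metis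
  have "comb k e y = 0"
    using comb_cong[of k e "\<lambda>_. 0" y y] e0 by (simp add: comb_def left_add.zero)
  moreover have "comb k e y = - (\<Sum>r\<in>?R. smul (of_real (d r * r)) (?v r))"
    unfolding comb_e sum_negf[symmetric]
    by (rule sum.cong) (simp_all add: y right_add.minus action_of_real_left scaleR_conv_of_real)
  ultimately have 1: "(\<Sum>r\<in>?R. smul (of_real (d r * r)) (?v r)) = 0"
    by simp
  \<comment> \<open>Subtracting \<open>q\<close> times the first relation from the second cancels
    the term of \<open>q\<close>.\<close>
  have "(\<Sum>r\<in>?R. smul (of_real (d r * (r - q))) (?v r))
      = (\<Sum>r\<in>?R. smul (of_real (d r * r)) (?v r))
        - smul (of_real q) (\<Sum>r\<in>?R. smul (of_real (d r)) (?v r))"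
    unfolding right_add.sum sum_subtractf[symmetric]
    by (rule sum.cong) (simp_all add: action_of_real_left scaleR_conv_of_real
        right_diff_distrib left_add.diff mult.commute flip: of_real_mult)
  also have "\<dots> = 0"
    by (simp only: 1 insert.prems(2) right_add.zero diff_self)
  finally have "(\<Sum>r\<in>S. smul (of_real (d r * (r - q))) (?v r)) = 0"
    using insert.hyps by (simp add: left_add.zero)
  then have "\<forall>r\<in>S. d r * (r - q) = 0"
    using insert.prems(1) by (intro insert.IH) auto
  then have dS: "\<forall>r\<in>S. d r = 0"
    using insert.hyps(2) by auto
  \<comment> \<open>Only the term of \<open>q\<close> survives in \<open>e\<close>, which vanishes
    on \<open>{1..k}\<close> although \<open>c q\<close> does not.\<close>
  then have "e i = d q *\<^sub>R c q i" for i
    using insert.hyps by (simp add: e_def)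
  then have "d q = 0"
    using e0 nz[of q] insert.prems(1) by (metis insert_subset scaleR_eq_0_iff)
  then show ?case
    using dS by simp
qed simp

lemma finite_dependent_pencil:
  assumes u: "left_independent smul k u" and "finite B" and B: "span B = (UNIV::'f set)"
  shows "finite {r::real. \<not> left_independent smul k (\<lambda>i. y i + smul (of_real r) (u i))}"
    (is "finite ?D")
proof -
  have "\<forall>r\<in>?D. \<exists>c. comb k c (\<lambda>i. y i + smul (of_real r) (u i)) = 0 \<and> (\<exists>i\<in>{1..k}. c i \<noteq> 0)"
    by (auto simp: independent_iff_comb)
  from bchoice[OF this] obtain c where
    c: "\<And>r. r \<in> ?D \<Longrightarrow> comb k (c r) (\<lambda>i. y i + smul (of_real r) (u i)) = 0"
    "\<And>r. r \<in> ?D \<Longrightarrow> \<exists>i\<in>{1..k}. c r i \<noteq> 0"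
    by blast
  have indep: "\<forall>r\<in>S. d r = 0"
    if "finite S" "S \<subseteq> ?D" "(\<Sum>r\<in>S. smul (of_real (d r)) (comb k (c r) u)) = 0" for S d
    by (rule pencil_independent[OF u c that])
  define v where "v = (\<lambda>r. comb k (c r) u)"
  \<comment> \<open>A finite set whose real span contains every combination of \<open>u\<close>; its
    cardinality bounds the number of exceptional parameters.\<close>
  define T where "T = (\<lambda>(b, i). smul b (u i)) ` (B \<times> {1..k})"
  have "finite T"
    using \<open>finite B\<close> by (simp add: T_def)
  have "smul a (u i) \<in> real_space.span T" if "i \<in> {1..k}" for a i
  proof -
    have "a \<in> span B"
      by (simp add: B)
    then show ?thesis
    proof (induction rule: span_induct_alt)
      case (step r b a)
      have "smul b (u i) \<in> T"
        using step that by (force simp: T_def)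
      then show ?case
        using step by (metis action_add_left action_of_real_left real_space.span_add
            real_space.span_base real_space.span_scale)
    qed (simp add: left_add.zero real_space.span_zero)
  qed
  then have v_span: "v r \<in> real_space.span T" for r
    unfolding v_def comb_def by (intro real_space.span_sum) blast
  have "card S \<le> card T" if S: "finite S" "S \<subseteq> ?D" for S
  proof -
    have inj: "inj_on v S"
    proof (rule inj_onI, rule ccontr)
      fix r s assume rs: "r \<in> S" "s \<in> S" "v r = v s" "r \<noteq> s"
      define d where "d = (\<lambda>t. if t = r then 1 else - 1 :: real)"
      have "(\<Sum>t\<in>{r, s}. smul (of_real (d t)) (v t)) = 0"
        using rs by (simp add: d_def left_add.minus)
      then have "d r = 0"
        using indep[where S = "{r, s}" and d = d] rs S(2) by (auto simp: v_def)
      then show False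
        by (simp add: d_def)
    qed
    have "real_space.independent (v ` S)"
    proof (rule real_space.independent_if_scalars_zero)
      fix f x assume "(\<Sum>x\<in>v ` S. smul (of_real (f x)) x) = 0" "x \<in> v ` S"
      then show "f x = 0"
        using indep[OF S, where d = "\<lambda>r. f (v r)"] inj by (auto simp: sum.reindex v_def)
    qed (use S in simp)
    then have "card (v ` S) \<le> card T"
      using real_space.independent_span_bound[OF \<open>finite T\<close>, of "v ` S"] v_span
      by (simp add: image_subset_iff)
    then show ?thesis
      using S inj by (simp add: card_image)
  qed
  then show ?thesis
    using finite_if_finite_subsets_card_bdd[of ?D "card T"] by blast
qed

end

section \<open>Topological and normed spaces\<close>

locale real_scalar_action_topology = real_scalar_action smul + vector_topology T
  for T :: "'x::ab_group_add topology" and smul :: "'f::real_normed_div_algebra \<Rightarrow> 'x \<Rightarrow> 'x" +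
  assumes continuous_action: "continuous_map (prod_topology euclidean T) T (\<lambda>(a, x). smul a x)"
begin

lemma continuous_map_add:
  assumes "continuous_map Z T f" "continuous_map Z T g"
  shows "continuous_map Z T (\<lambda>z. f z + g z)"
  using continuous_map_compose[OF continuous_map_pairedI[OF assms] continuous_add]
  by (simp add: o_def)

lemma continuous_map_smul:
  assumes "continuous_map Z euclidean f" "continuous_map Z T g"
  shows "continuous_map Z T (\<lambda>z. smul (f z) (g z))"
  using continuous_map_compose[OF continuous_map_pairedI[OF assms] continuous_action]
  by (simp add: o_def)

lemma continuous_map_vector_sum:
  assumes "finite I" "\<And>i. i \<in> I \<Longrightarrow> continuous_map Z T (f i)"
  shows "continuous_map Z T (\<lambda>z. \<Sum>i\<in>I. f i z)"
  using assms
  by (induction I rule: finite_induct) (auto simp: topspace_UNIV intro!: continuous_map_add)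

lemma openin_independent:
  assumes "compact (cball (0::'f) 1)"
  shows "openin (product_topology (\<lambda>_. T) {1..k}) (left_independent_tuples smul k)"
proof -
  let ?P = "product_topology (\<lambda>_. T) {1..k}"
  let ?K = "subtopology euclidean (unit_tuples k :: (nat \<Rightarrow> 'f) set)"
  let ?Z = "{z \<in> topspace (prod_topology ?K ?P). comb k (fst z) (snd z) \<in> {0}}"
  have "continuous_map (prod_topology ?K ?P) euclidean (\<lambda>z. fst z i)" for i
  proof -
    have "continuous_map ?K euclidean (\<lambda>c. c i)"
      using continuous_on_subset[OF continuous_on_product_coordinates[of i] subset_UNIV] by simp
    then show ?thesis
      by (rule continuous_map_compose[OF continuous_map_fst, unfolded o_def])
  qed
  moreover have "continuous_map (prod_topology ?K ?P) T (\<lambda>z. snd z i)" if "i \<in> {1..k}" for i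
    using continuous_map_compose[OF continuous_map_snd continuous_map_product_projection[OF that]]
    by (simp add: o_def)
  ultimately have "continuous_map (prod_topology ?K ?P) T (\<lambda>z. comb k (fst z) (snd z))"
    unfolding comb_def by (intro continuous_map_vector_sum continuous_map_smul) auto
  \<comment> \<open>\<open>{0}\<close> is closed because \<open>T\<close> is Hausdorff.\<close>
  then have "closedin (prod_topology ?K ?P) ?Z"
    by (rule closedin_continuous_map_preimage)
      (simp add: closedin_Hausdorff_singleton Hausdorff topspace_UNIV)
  moreover have "compact_space ?K"
    using compact_unit_tuples[OF assms] by (simp add: compact_space_subtopology)
  \<comment> \<open>Projection along the compact factor \<open>?K\<close> is a closed map.\<close>
  ultimately have "closedin ?P (snd ` ?Z)"
    using closed_map_snd by (auto simp: closed_map_def)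
  moreover have "topspace ?P - snd ` ?Z = left_independent_tuples smul k"
  proof (rule set_eqI)
    fix x
    have "x \<in> snd ` ?Z \<longleftrightarrow> x \<in> topspace ?P \<and> (\<exists>c\<in>unit_tuples k. comb k c x = 0)"
      by (auto simp: image_iff)
    also have "\<dots> \<longleftrightarrow> x \<in> topspace ?P \<and> \<not> left_independent smul k x"
      by (simp only: dependent_iff_unit_tuple)
    finally show "x \<in> topspace ?P - snd ` ?Z \<longleftrightarrow> x \<in> left_independent_tuples smul k"
      by (auto simp: left_independent_tuples_def topspace_UNIV)
  qed
  ultimately show ?thesis
    using openin_diff[OF openin_topspace] by fastforce
qed

lemma dense_independent:
  assumes "finite B" "span B = (UNIV::'f set)" and "left_independent_tuples smul k \<noteq> {}"
  shows "product_topology (\<lambda>_. T) {1..k} closure_of left_independent_tuples smul k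
    = topspace (product_topology (\<lambda>_. T) {1..k})"
    (is "?P closure_of _ = _")
proof -
  obtain u where u: "left_independent smul k u"
    using assms(3) by (auto simp: left_independent_tuples_def)
  have "\<exists>x. x \<in> left_independent_tuples smul k \<inter> W" if W: "openin ?P W" "y \<in> W" for W y
  proof -
    \<comment> \<open>The line through \<open>y\<close> in direction \<open>u\<close>, restricted to
      \<open>{1..k}\<close> so that its values are points of the product space.\<close>
    define f where "f = (\<lambda>r::real. \<lambda>i\<in>{1..k}. y i + smul (of_real r) (u i))"
    have "continuous_map euclidean euclidean (\<lambda>r. of_real r :: 'f)"
      by (simp add: continuous_intros)
    then have "continuous_map euclidean ?P f"
      unfolding continuous_map_componentwise f_def
      by (auto simp: topspace_UNIV intro!: continuous_map_add continuous_map_smul)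
    then have "open {r. f r \<in> W}"
      using openin_continuous_map_preimage[OF _ W(1)] by fastforce
    moreover have "y \<in> extensional {1..k}"
      using openin_subset[OF W(1)] W(2) by (auto simp: PiE_def)
    then have "f 0 = y"
      by (auto simp: f_def left_add.zero restrict_def extensional_def)
    \<comment> \<open>An open set of reals containing \<open>0\<close> is infinite, so it is not
      exhausted by the finitely many dependent parameters.\<close>
    ultimately have "infinite {r. f r \<in> W}"
      using finite_imp_not_open W(2) by blast
    then obtain r where r: "f r \<in> W"
      "left_independent smul k (\<lambda>i. y i + smul (of_real r) (u i))"
      using finite_dependent_pencil[OF u assms(1,2), of y]
      by (metis (mono_tags, lifting) finite_subset mem_Collect_eq subsetI)
    then have "left_independent smul k (f r)"
      using independent_cong[of k "f r"] by (simp add: f_def)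
    moreover have "f r \<in> {1..k} \<rightarrow>\<^sub>E UNIV"
      by (simp add: f_def)
    ultimately show ?thesis
      using r(1) by (auto simp: left_independent_tuples_def)
  qed
  then show ?thesis
    unfolding closure_of_def using openin_subset by fast
qed

end

section \<open>Perturbation in normed spaces\<close>

locale real_scalar_action_norm = real_scalar_action smul
  for smul :: "'f::real_normed_div_algebra \<Rightarrow> 'x::ab_group_add \<Rightarrow> 'x" +
  fixes nrm :: "'x \<Rightarrow> real"
  assumes nrm_eq_zero: "nrm x = 0 \<longleftrightarrow> x = 0"
    and nrm_triangle: "nrm (x + y) \<le> nrm x + nrm y"
    and nrm_action: "nrm (smul a x) = norm a * nrm x"
begin

lemma nrm_minus: "nrm (- x) = nrm x"
  using nrm_action[of "- 1" x] by (simp add: left_add.minus action_one)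

lemma nrm_nonneg: "0 \<le> nrm x"
  using nrm_triangle[of x "- x"] nrm_eq_zero[of "0::'x"] by (simp add: nrm_minus)

lemma nrm_comb_le: "nrm (comb k c x) \<le> (\<Sum>i\<in>{1..k}. norm (c i) * nrm (x i))"
proof -
  have "nrm (\<Sum>i\<in>I. smul (c i) (x i)) \<le> (\<Sum>i\<in>I. norm (c i) * nrm (x i))" if "finite I" for I
    using that
  proof (induction I rule: finite_induct)
    case (insert i I)
    then show ?case
      using nrm_triangle[of "smul (c i) (x i)" "\<Sum>i\<in>I. smul (c i) (x i)"]
      by (simp add: nrm_action)
  qed (simp add: nrm_eq_zero[THEN iffD2])
  then show ?thesis
    by (simp add: comb_def)
qed

lemma abs_nrm_diff_le: "\<bar>nrm x - nrm y\<bar> \<le> nrm (x - y)"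
  using nrm_triangle[of "x - y" y] nrm_triangle[of "y - x" x] nrm_minus[of "x - y"] by simp

text \<open>The change of the value is at most
  \<open>\<Sum>i\<in>{1..k}. norm (d i - c i) * nrm (x i)\<close>, which tends to \<open>0\<close>
  under pointwise convergence of the coefficients.\<close>

lemma continuous_nrm_comb: "continuous_on UNIV (\<lambda>c. nrm (comb k c x))"
  unfolding continuous_on_def
proof (intro ballI)
  fix c :: "nat \<Rightarrow> 'f"
  have "((\<lambda>d. d i) \<longlongrightarrow> c i) (at c)" for i
    using continuous_on_product_coordinates[of i] unfolding continuous_on_def by auto
  then have "((\<lambda>d. \<Sum>i\<in>{1..k}. norm (d i - c i) * nrm (x i)) \<longlongrightarrow>
      (\<Sum>i\<in>{1..k}. norm (c i - c i) * nrm (x i))) (at c)"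
    by (intro tendsto_intros)
  then have lim: "((\<lambda>d. \<Sum>i\<in>{1..k}. norm (d i - c i) * nrm (x i)) \<longlongrightarrow> 0) (at c)"
    by simp
  have "comb k d x - comb k c x = comb k (\<lambda>i. d i - c i) x" for d
    by (simp add: comb_def left_add.diff sum_subtractf)
  then have "\<bar>nrm (comb k d x) - nrm (comb k c x)\<bar> \<le> (\<Sum>i\<in>{1..k}. norm (d i - c i) * nrm (x i))"
    for d
    using abs_nrm_diff_le nrm_comb_le order_trans by metis
  then have "((\<lambda>d. nrm (comb k d x) - nrm (comb k c x)) \<longlongrightarrow> 0) (at c)"
    by (intro Lim_null_comparison[OF _ lim] always_eventually allI) (simp only: real_norm_def)
  then show "((\<lambda>d. nrm (comb k d x)) \<longlongrightarrow> nrm (comb k c x)) (at c within UNIV)"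
    by (rule LIM_zero_cancel)
qed

text \<open>On the compact set of unit tuples, \<open>nrm (comb k c x)\<close> has a positive
  minimum \<open>\<delta>\<close>. Moving each of the \<open>k\<close> vectors by less than
  \<open>\<delta> / k\<close> changes such a combination by less than \<open>\<delta>\<close>, so it
  cannot become \<open>0\<close>.\<close>

lemma norm_perturbation_independent:
  assumes "compact (cball (0::'f) 1)" and x: "left_independent smul k x"
  shows "\<exists>\<epsilon>>0. \<forall>y. (MAX i\<in>{1..k}. nrm (y i - x i)) < \<epsilon> \<longrightarrow> left_independent smul k y"
proof (cases "(unit_tuples k :: (nat \<Rightarrow> 'f) set) = {}")
  \<comment> \<open>This is the case \<open>k = 0\<close>: every \<open>y\<close> is independent,
    whatever the value of the maximum over the empty set.\<close>
  case True
  then show ?thesis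
    using dependent_iff_unit_tuple by (metis empty_iff zero_less_one)
next
  case False
  then have "k > 0"
    by (auto simp: unit_tuples_iff)
  obtain c where c: "c \<in> unit_tuples k"
    "\<And>d. d \<in> unit_tuples k \<Longrightarrow> nrm (comb k c x) \<le> nrm (comb k d x)"
    using continuous_attains_inf[OF compact_unit_tuples[OF assms(1)] False
        continuous_on_subset[OF continuous_nrm_comb]] by blast
  define \<delta> where "\<delta> = nrm (comb k c x)"
  have "\<delta> > 0"
    using dependent_iff_unit_tuple[of k x] x c(1) nrm_eq_zero nrm_nonneg[of "comb k c x"]
    by (metis \<delta>_def less_eq_real_def)
  moreover have "left_independent smul k y" if y: "(MAX i\<in>{1..k}. nrm (y i - x i)) < \<delta> / k" for y
  proof (rule ccontr)
    assume "\<not> left_independent smul k y"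
    then obtain d where d: "d \<in> unit_tuples k" "comb k d y = 0"
      by (auto simp: dependent_iff_unit_tuple)
    have less: "nrm (y i - x i) < \<delta> / k" if "i \<in> {1..k}" for i
      using y that by (subst (asm) Max_less_iff) auto
    have "\<delta> \<le> nrm (comb k d x)"
      using c(2)[OF d(1)] by (simp add: \<delta>_def)
    \<comment> \<open>Since \<open>comb k d y = 0\<close>, the two combinations differ only in
      sign.\<close>
    also have "\<dots> = nrm (comb k d (\<lambda>i. y i - x i))"
      by (simp add: comb_diff d(2) nrm_minus)
    also have "\<dots> \<le> (\<Sum>i\<in>{1..k}. norm (d i) * nrm (y i - x i))"
      by (rule nrm_comb_le)
    also have "\<dots> \<le> (\<Sum>i\<in>{1..k}. nrm (y i - x i))"
      using d(1) by (intro sum_mono mult_left_le_one_le) (auto simp: unit_tuples_iff nrm_nonneg)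
    also have "\<dots> < (\<Sum>i\<in>{1..k}. \<delta> / k)"
      using less \<open>k > 0\<close> by (intro sum_strict_mono) auto
    also have "\<dots> = \<delta>"
      using \<open>k > 0\<close> by simp
    finally show False
      by simp
  qed
  ultimately show ?thesis
    using \<open>k > 0\<close> by (intro exI[of _ "\<delta> / k"]) simp
qed

end

section \<open>Left and right spaces\<close>

text \<open>Centrality of the reals is what gives left and right actions the same laws for real
  scalars.\<close>

lemma of_real_mult_commute: "of_real r * a = a * (of_real r :: 'f::real_algebra_1)"
  by (simp add: of_real_def)

lemma left_real_scalar_action:
  assumes "left_vector_space smul"
  shows "real_scalar_action smul"
proof -
  interpret left_vector_space smul
    by (rule assms)
  show ?thesis
    by unfold_locales
      (simp_all add: smul_add_right smul_add_left smul_smul smul_one scaleR_conv_of_real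
        of_real_mult_commute)
qed

lemma right_real_scalar_action:
  assumes "right_vector_space smul"
  shows "real_scalar_action (\<lambda>a x. smul x a)"
proof -
  interpret right_vector_space smul
    by (rule assms)
  show ?thesis
    by unfold_locales
      (simp_all add: smul_add_right smul_add_left smul_smul smul_one scaleR_conv_of_real
        of_real_mult_commute)
qed

lemma left_topological_action:
  "left_topological_vector_space T smul \<Longrightarrow> real_scalar_action_topology T smul"
  by (simp add: left_topological_vector_space_def left_topological_vector_space_axioms_def
      real_scalar_action_topology_def real_scalar_action_topology_axioms_def
      left_real_scalar_action)

lemma right_topological_action:
  assumes "right_topological_vector_space T smul"
  shows "real_scalar_action_topology T (\<lambda>a x. smul x a)"
proof -
  interpret right_topological_vector_space T smul
    by (rule assms)
  \<comment> \<open>The flipped action is the given one after exchanging the two factors.\<close>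
  have "continuous_map (prod_topology euclidean T) T ((\<lambda>(x, a). smul x a) \<circ> (\<lambda>z. (snd z, fst z)))"
    by (rule continuous_map_compose[OF _ continuous_smul])
      (intro continuous_map_pairedI continuous_map_fst continuous_map_snd)
  then have "continuous_map (prod_topology euclidean T) T (\<lambda>(a, x). smul x a)"
    by (simp add: o_def case_prod_unfold)
  then show ?thesis
    by (intro real_scalar_action_topology.intro real_scalar_action_topology_axioms.intro
        right_real_scalar_action right_vector_space_axioms vector_topology_axioms)
qed

lemma left_norm_action: "left_normed_space smul nrm \<Longrightarrow> real_scalar_action_norm smul nrm"
  by (simp add: left_normed_space_def left_normed_space_axioms_def
      real_scalar_action_norm_def real_scalar_action_norm_axioms_def left_real_scalar_action)

lemma right_norm_action:
  "right_normed_space smul nrm \<Longrightarrow> real_scalar_action_norm (\<lambda>a x. smul x a) nrm"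
  by (simp add: right_normed_space_def right_normed_space_axioms_def mult.commute
      real_scalar_action_norm_def real_scalar_action_norm_axioms_def right_real_scalar_action)

text \<open>This reduces the right-handed claims to the left-handed ones for the flipped
  action.\<close>

lemma right_independent_eq: "right_independent smul = left_independent (\<lambda>a x. smul x a)"
  by (simp add: fun_eq_iff right_independent_def left_independent_def)

lemma right_independent_tuples_eq:
  "right_independent_tuples smul = left_independent_tuples (\<lambda>a x. smul x a)"
  by (simp add: fun_eq_iff right_independent_tuples_def left_independent_tuples_def
      right_independent_eq)


theorem theorem5p1:
  fixes k :: nat
    and T :: "'x::ab_group_add topology"
    and nrm :: "'x \<Rightarrow> real"
    and lsmul :: "'f::real_complex_quat \<Rightarrow> 'x \<Rightarrow> 'x"
    and rsmul :: "'x \<Rightarrow> 'f \<Rightarrow> 'x"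
  shows
    "(left_topological_vector_space T lsmul \<longrightarrow>
        openin (product_topology (\<lambda>_. T) {1..k}) (left_independent_tuples lsmul k)) \<and>
     (right_topological_vector_space T rsmul \<longrightarrow>
        openin (product_topology (\<lambda>_. T) {1..k}) (right_independent_tuples rsmul k)) \<and>
     (left_normed_space lsmul nrm \<longrightarrow>
        (\<forall>x. left_independent lsmul k x \<longrightarrow>
          (\<exists>\<epsilon>>0. \<forall>y. (MAX i\<in>{1..k}. nrm (y i - x i)) < \<epsilon> \<longrightarrow> left_independent lsmul k y))) \<and>
     (right_normed_space rsmul nrm \<longrightarrow>
        (\<forall>x. right_independent rsmul k x \<longrightarrow>
          (\<exists>\<epsilon>>0. \<forall>y. (MAX i\<in>{1..k}. nrm (y i - x i)) < \<epsilon> \<longrightarrow> right_independent rsmul k y))) \<and>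
     (left_topological_vector_space T lsmul \<longrightarrow>
        left_independent_tuples lsmul k \<noteq> {} \<longrightarrow>
        product_topology (\<lambda>_. T) {1..k} closure_of left_independent_tuples lsmul k
          = topspace (product_topology (\<lambda>_. T) {1..k})) \<and>
     (right_topological_vector_space T rsmul \<longrightarrow>
        right_independent_tuples rsmul k \<noteq> {} \<longrightarrow>
        product_topology (\<lambda>_. T) {1..k} closure_of right_independent_tuples rsmul k
          = topspace (product_topology (\<lambda>_. T) {1..k}))"
proof -
  have cpt: "compact (cball (0::'f) 1)"
    using scalars_finite_dim by blast
  obtain B :: "'f set" where B: "finite B" "span B = UNIV"
    using scalars_finite_dim by blast
  note action = left_topological_action right_topological_action
    left_norm_action right_norm_action
  note independent = real_scalar_action_topology.openin_independent[OF _ cpt]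
    real_scalar_action_topology.dense_independent[OF _ B]
    real_scalar_action_norm.norm_perturbation_independent[OF _ cpt]
  show ?thesis
    unfolding right_independent_eq right_independent_tuples_eq
    by (intro conjI impI allI; rule independent; (rule action)?; assumption)
qed

end
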